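(* Let $\mathcal{A}$ be a hypercomplex algebra over a field $\mathbb{K}$ with principal units $u_1,\dots,u_n$, and let $\{\mathrm e_p\}_{p=0}^{2^n-1}$ be its standard basis. Then the index function of the standard basis is the componentwise XOR function $r(p,q)=p\oplus q$; that is, there is a function $s:\{0,\dots,2^n-1\}^2\to\mathbb{K}$ such that $$\mathrm e_p\,\mathrm e_q = s(p,q)\,\mathrm e_{p\oplus q}\qquad\text{for all } p,q\in\{0,\dots,2^n-1\}.$$
   Context: Hypercomplex algebra: let $\mathbb{K}$ be a field and $n\ge 0$ an integer. A hypercomplex algebra over $\mathbb{K}$ with principal units $u_1,\dots,u_n$ is an associative unital $\mathbb{K}$-algebra $\mathcal{A}$ (product written by juxtaposition, $\mathbb{K}$-bilinear, unit $1$) generated by $u_1,\dots,u_n$ such that (i) there is a single $\lambda\in\mathbb{K}$ with $u_iu_j=\lambda u_ju_i$ for all $i\ne j$; (ii) $u_i^2\in\{-1,0,1\}$ for each $i$; (iii) the $2^n$ ordered products $$\mathrm e_p:=\prod_{k=0}^{n-1}u_{k+1}^{p_k}=u_1^{p_0}u_2^{p_1}\cdots u_n^{p_{n-1}},\qquad p=\sum_{k=0}^{n-1}p_k2^k,\ p_k\in\{0,1\},\ u_j^0:=1,$$ for $0\le p<2^n$, form a $\mathbb{K}$-basis of $\mathcal{A}$, called the standard basis. Multiplier and index functions: if a basis $\{\mathrm e_k\}$ of an algebra satisfies $\mathrm e_p\mathrm e_q=s(p,q)\mathrm e_{r(p,q)}$ for all $p,q$, with scalars $s(p,q)$ and indices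 $r(p,q)$, then $s$ is called a multiplier function and $r$ an index function of the basis. $p\oplus q$ denotes bitwise XOR of nonnegative integers: if $p=\sum p_k2^k$ and $q=\sum q_k2^k$ with $p_k,q_k\in\{0,1\}$, then $p\oplus q=\sum_k (p_k\oplus q_k)2^k$, where $p_k\oplus q_k=p_k+q_k \bmod 2$. *)

theory Defs
  imports Main "HOL.Vector_Spaces"
begin

locale unital_algebra = vector_space scale
  for scale :: "'k::field \<Rightarrow> 'a::ring_1 \<Rightarrow> 'a" (infixr \<open>*s\<close> 75) +
  assumes scale_mult_left: "(a *s x) * y = a *s (x * y)"
    and scale_mult_right: "x * (a *s y) = a *s (x * y)"
begin

definition subalgebra :: "'a set \<Rightarrow> bool"
  where "subalgebra S \<longleftrightarrow> subspace S \<and> 1 \<in> S \<and> (\<forall>x\<in>S. \<forall>y\<in>S. x * y \<in> S)"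

definition generates :: "'a set \<Rightarrow> bool"
  where "generates X \<longleftrightarrow> subalgebra hull X = UNIV"

text \<open>Injectivity is required because independence is a property of the set of values,
  not of the family.\<close>

definition basis_family :: "'i set \<Rightarrow> ('i \<Rightarrow> 'a) \<Rightarrow> bool"
  where "basis_family I e \<longleftrightarrow> inj_on e I \<and> independent (e ` I) \<and> span (e ` I) = UNIV"

text \<open>The scalar \<open>s p q\<close> and the index \<open>r p q\<close> only matter for \<open>p, q \<in> I\<close>.
  An index function need not be unique, since \<open>s p q\<close> may vanish.\<close>

definition multiplier_index_functions ::
    "'i set \<Rightarrow> ('i \<Rightarrow> 'a) \<Rightarrow> ('i \<Rightarrow> 'i \<Rightarrow> 'k) \<Rightarrow> ('i \<Rightarrow> 'i \<Rightarrow> 'i) \<Rightarrow> bool"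
  where "multiplier_index_functions I e s r \<longleftrightarrow>
    basis_family I e \<and>
    (\<forall>p\<in>I. \<forall>q\<in>I. r p q \<in> I \<and> e p * e q = s p q *s e (r p q))"

end

text \<open>The product \<open>u\<^sub>1^p\<^sub>0 u\<^sub>2^p\<^sub>1 \<dots>\<close> in increasing order of the
  indices, where \<open>p\<^sub>k\<close> is the \<open>k\<close>-th binary digit of \<open>p\<close>; the principal units are
  \<open>u 1, \<dots>, u n\<close>.\<close>

definition standard_basis :: "nat \<Rightarrow> (nat \<Rightarrow> 'a::monoid_mult) \<Rightarrow> nat \<Rightarrow> 'a"
  where "standard_basis n u p = prod_list (map (\<lambda>k. u (k + 1) ^ of_bool (bit p k)) [0..<n])"

locale hypercomplex_algebra = unital_algebra scale
  for scale :: "'k::field \<Rightarrow> 'a::ring_1 \<Rightarrow> 'a" (infixr \<open>*s\<close> 75)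
    and n :: nat and u :: "nat \<Rightarrow> 'a" +
  assumes units_generate: "generates (u ` {1..n})"
    and units_commute: "\<exists>l. \<forall>i\<in>{1..n}. \<forall>j\<in>{1..n}. i \<noteq> j \<longrightarrow> u i * u j = l *s (u j * u i)"
    and units_square: "i \<in> {1..n} \<Longrightarrow> u i ^ 2 \<in> {-1, 0, 1}"
    and standard_basis: "basis_family {0..<2 ^ n} (standard_basis n u)"

end

theory Submission
  imports Defs
begin

text \<open>Induction on the number of units, with \<open>p\<close> and \<open>q\<close> fixed,
  since \<open>standard_basis m u p\<close> reads only the lowest \<open>m\<close> digits of
  \<open>p\<close>. With v the last unit and a, b the last digits, the product is e_p v^a e_q v^b.
  Moving v^a past e_q costs a scalar (\<open>commute_standard_basis\<close>); e_p e_q is covered by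
  induction, and v^a v^b is a scalar times v^(a xor b) because v^2 is a scalar. So digits add modulo
  2 (\<open>standard_basis_mult\<close>).\<close>

lemma standard_basis_Suc:
  "standard_basis (Suc n) u p = standard_basis n u p * u (Suc n) ^ of_bool (bit p n)"
  by (simp add: standard_basis_def)

context unital_algebra
begin

text \<open>Passing \<open>x\<close> through the factors one at a time multiplies the scalars
  collected. It is applied with \<open>x\<close> the next unit.\<close>

lemma commute_standard_basis:
  assumes "\<And>i. i \<in> {1..m} \<Longrightarrow> \<exists>c. x * u i = c *s (u i * x)"
  shows "\<exists>c. x * standard_basis m u q = c *s (standard_basis m u q * x)"
  using assms
proof (induction m)
  case 0
  have "x * standard_basis 0 u q = 1 *s (standard_basis 0 u q * x)"
    by (simp add: standard_basis_def)
  then show ?case by blast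
next
  case (Suc m)
  obtain c where c: "x * standard_basis m u q = c *s (standard_basis m u q * x)"
    using Suc by fastforce
  obtain d where d: "x * u (Suc m) = d *s (u (Suc m) * x)"
    using Suc.prems[of "Suc m"] by auto
  show ?case
  proof (cases "bit q m")
    case True
    have "x * standard_basis (Suc m) u q = c *s (standard_basis m u q * (x * u (Suc m)))"
      using True c by (simp add: standard_basis_Suc scale_mult_left flip: mult.assoc)
    also have "\<dots> = (c * d) *s (standard_basis (Suc m) u q * x)"
      using True d by (simp add: standard_basis_Suc scale_mult_right mult.assoc)
    finally show ?thesis by blast
  next
    case False
    then show ?thesis using c by (auto simp: standard_basis_Suc)
  qed
qed

text \<open>Only units of larger index move past units of smaller index, so the commutation scalars
  need not be invertible.\<close>

lemma standard_basis_mult: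
  assumes "\<And>i j. i \<in> {1..m} \<Longrightarrow> j \<in> {1..m} \<Longrightarrow> i \<noteq> j \<Longrightarrow> \<exists>c. u i * u j = c *s (u j * u i)"
    and "\<And>i. i \<in> {1..m} \<Longrightarrow> \<exists>c. u i * u i = c *s 1"
  shows "\<exists>c. standard_basis m u p * standard_basis m u q = c *s standard_basis m u (xor p q)"
  using assms
proof (induction m)
  case 0
  have "standard_basis 0 u p * standard_basis 0 u q = 1 *s standard_basis 0 u (xor p q)"
    by (simp add: standard_basis_def)
  then show ?case by blast
next
  case (Suc m)
  let ?v = "u (Suc m)" and ?e = "standard_basis m u"
  let ?a = "of_bool (bit p m) :: nat" and ?b = "of_bool (bit q m) :: nat"
  obtain c where c: "?e p * ?e q = c *s ?e (xor p q)"
    using Suc by fastforce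
  have "\<exists>d. ?v * ?e q = d *s (?e q * ?v)"
    by (rule commute_standard_basis) (use Suc.prems(1) in auto)
  \<comment> \<open>For digit 0 the power is 1, so the scalar 1 serves.\<close>
  then obtain d where d: "?v ^ ?a * ?e q = d *s (?e q * ?v ^ ?a)"
    by (cases "bit p m") (auto intro: that that[of 1])
  have "\<exists>f. ?v * ?v = f *s 1"
    using Suc.prems(2)[of "Suc m"] by auto
  \<comment> \<open>Only when both digits are 1 does the square of \<open>?v\<close> arise; it
    collapses to a scalar, matching XOR digit 0. Otherwise the scalar is 1.\<close>
  then obtain f where f: "?v ^ ?a * ?v ^ ?b = f *s ?v ^ of_bool (bit (xor p q) m)"
    by (cases "bit p m"; cases "bit q m") (auto simp: bit_xor_iff intro: that that[of 1])
  have "standard_basis (Suc m) u p * standard_basis (Suc m) u q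
      = ?e p * (?v ^ ?a * ?e q) * ?v ^ ?b"
    by (simp only: standard_basis_Suc mult.assoc)
  also have "\<dots> = d *s ((?e p * ?e q) * (?v ^ ?a * ?v ^ ?b))"
    by (simp only: d scale_mult_left scale_mult_right mult.assoc)
  also have "\<dots> = (d * c * f) *s standard_basis (Suc m) u (xor p q)"
    by (simp only: c f standard_basis_Suc scale_mult_left scale_mult_right scale_scale ac_simps)
  finally show ?case by blast
qed

end

theorem theorem7:
  fixes scale :: "'k::field \<Rightarrow> 'a::ring_1 \<Rightarrow> 'a"
    and n :: nat
    and u :: "nat \<Rightarrow> 'a"
  assumes "hypercomplex_algebra scale n u"
  shows "\<exists>s. unital_algebra.multiplier_index_functions scale {0..<2 ^ n} (standard_basis n u) s
    Bit_Operations.xor"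
proof -
  interpret hypercomplex_algebra scale n u by (rule assms)
  have "\<exists>c. u i * u i = scale c 1" if "i \<in> {1..n}" for i
  proof -
    \<comment> \<open>The three admissible squares are scalar multiples of the identity.\<close>
    have "- 1 = scale (- 1) 1" "0 = scale 0 1" "1 = scale 1 1" by simp_all
    then show ?thesis
      using units_square[OF that] unfolding power2_eq_square by (metis insertE singletonD)
  qed
  then have "\<exists>c. standard_basis n u p * standard_basis n u q
      = scale c (standard_basis n u (xor p q))" for p q
    using units_commute by (intro standard_basis_mult) blast+
  then obtain s where "\<And>p q. standard_basis n u p * standard_basis n u q
      = scale (s p q) (standard_basis n u (xor p q))"
    by metis
  \<comment> \<open>Being below \<open>2 ^ n\<close> means being fixed by truncation to
    \<open>n\<close> bits, which distributes over XOR.\<close>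
  moreover have "xor p q < 2 ^ n" if "p < 2 ^ n" "q < 2 ^ n" for p q :: nat
    using that by (simp add: take_bit_xor flip: take_bit_nat_eq_self_iff)
  ultimately show ?thesis
    using standard_basis by (auto simp: multiplier_index_functions_def)
qed

end
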